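(* $\mathbf{se}\le\mathbf{e}'$.
   Context: For $n\in\omega$ let $e_n\in\mathbb{Z}^\omega$ be the unit vector with $e_n(n)=1$ and $e_n(i)=0$ for $i\neq n$. $\mathbf{se}$ is the least cardinality of a subgroup $G\le\mathbb{Z}^\omega$ with $\bigoplus_n\langle e_n\rangle\le G$ such that every group homomorphism $h:G\to\mathbb{Z}$ satisfies $h(e_n)=0$ for all but finitely many $n$. A generalized predictor (in the sense used here) is $\pi=(D_\pi,E_\pi,(\pi_n;\,n\in\omega))$ where $D_\pi=\{k_n;\,n\in\omega\}$ and $E_\pi=\{\ell_n;\,n\in\omega\}$ are subsets of $\omega$ with $k_n\le\ell_n<k_{n+1}$ for all $n$, and $\pi_n:\omega^{\ell_n\setminus\{k_n\}}\to\omega$; $\pi$ predicts $f\in\omega^\omega$ iff for all but finitely many $n$, $\pi_n(f\restriction(\ell_n\setminus\{k_n\}))=f(k_n)$; otherwise $f$ evades $\pi$. $\mathbf{e}'$ is the least size of a set $F\subseteq\omega^\omega$ such that for every countable set $\Pi$ of such predictors there is $f\in F$ evading all $\pi\in\Pi$. *)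

theory Defs
  imports "HOL-Algebra.Algebra" "HOL-Library.Countable_Set"
begin

unbundle cardinal_syntax

text \<open>
  The cardinality of a set \<open>A\<close> is the cardinal order \<open>|A|\<close>; two sets of the same size have
  order-isomorphic (\<open>=o\<close>) but in general not identical cardinal orders. Accordingly, the least
  cardinality of a member of \<open>\<S>\<close> is determined up to \<open>=o\<close>, which \<open>\<le>o\<close> does not distinguish.
  The value is unspecified for \<open>\<S> = {}\<close>.
\<close>

definition least_card :: "'a set set \<Rightarrow> 'a rel" where
  "least_card \<S> = (SOME r. r \<in> card_of ` \<S> \<and> (\<forall>S\<in>\<S>. r \<le>o |S| ))"

lemma least_card:
  assumes "\<S> \<noteq> {}"
  shows least_card_in: "least_card \<S> \<in> card_of ` \<S>"
    and least_card_le: "S \<in> \<S> \<Longrightarrow> least_card \<S> \<le>o |S|"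
proof -
  have "\<exists>r \<in> card_of ` \<S>. \<forall>r' \<in> card_of ` \<S>. r \<le>o r'"
    using assms by (intro exists_minim_Card_order) (auto simp: card_of_Card_order)
  then have "\<exists>r. r \<in> card_of ` \<S> \<and> (\<forall>S\<in>\<S>. r \<le>o |S| )"
    by blast
  from someI_ex[OF this] show "least_card \<S> \<in> card_of ` \<S>"
    and "S \<in> \<S> \<Longrightarrow> least_card \<S> \<le>o |S|"
    unfolding least_card_def by blast+
qed

definition Z_omega :: "(nat \<Rightarrow> int) monoid" where
  "Z_omega = product_group UNIV (\<lambda>_. integer_group)"

definition unit_vec :: "nat \<Rightarrow> nat \<Rightarrow> int" where
  "unit_vec n = (\<lambda>i. if i = n then 1 else 0)"

text \<open>The internal direct sum of the cyclic groups \<open>\<langle>e\<^sub>n\<rangle>\<close>, as a subset of \<open>\<int>\<^sup>\<omega>\<close>.\<close>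

definition unit_vec_sum :: "(nat \<Rightarrow> int) set" where
  "unit_vec_sum = generate Z_omega (\<Union>n. generate Z_omega {unit_vec n})"

definition specker_subgroup :: "(nat \<Rightarrow> int) set \<Rightarrow> bool" where
  "specker_subgroup G \<longleftrightarrow>
     subgroup G Z_omega \<and> unit_vec_sum \<subseteq> G \<and>
     (\<forall>h \<in> hom (Z_omega\<lparr>carrier := G\<rparr>) integer_group. \<forall>\<^sub>\<infinity>n. h (unit_vec n) = 0)"

definition se :: "(nat \<Rightarrow> int) rel" where
  "se = least_card {G. specker_subgroup G}"

text \<open>
  The sets \<open>D\<^sub>\<pi>\<close> and \<open>E\<^sub>\<pi>\<close> are the ranges of the (necessarily strictly increasing) enumerations
  \<open>pos \<pi>\<close> and \<open>bnd \<pi>\<close>. The natural number \<open>\<ell>\<close> is the set \<open>{..<\<ell>}\<close> of its predecessors, and a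
  function on a subset of \<open>\<omega>\<close> is a total function that is \<open>undefined\<close> off that subset.
\<close>

record predictor =
  pos :: "nat \<Rightarrow> nat"
  bnd :: "nat \<Rightarrow> nat"
  guess :: "nat \<Rightarrow> (nat \<Rightarrow> nat) \<Rightarrow> nat"

definition window :: "predictor \<Rightarrow> nat \<Rightarrow> nat set" where
  "window \<pi> n = {..<bnd \<pi> n} - {pos \<pi> n}"

definition is_predictor :: "predictor \<Rightarrow> bool" where
  "is_predictor \<pi> \<longleftrightarrow>
     (\<forall>n. pos \<pi> n \<le> bnd \<pi> n \<and> bnd \<pi> n < pos \<pi> (Suc n)) \<and>
     (\<forall>n. guess \<pi> n \<in> (window \<pi> n \<rightarrow>\<^sub>E UNIV) \<rightarrow>\<^sub>E UNIV)"

definition predicts :: "predictor \<Rightarrow> (nat \<Rightarrow> nat) \<Rightarrow> bool" where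
  "predicts \<pi> f \<longleftrightarrow> (\<forall>\<^sub>\<infinity>n. guess \<pi> n (restrict f (window \<pi> n)) = f (pos \<pi> n))"

abbreviation evades :: "(nat \<Rightarrow> nat) \<Rightarrow> predictor \<Rightarrow> bool" where
  "evades f \<pi> \<equiv> \<not> predicts \<pi> f"

definition evading_family :: "(nat \<Rightarrow> nat) set \<Rightarrow> bool" where
  "evading_family F \<longleftrightarrow>
     (\<forall>P. countable P \<and> (\<forall>\<pi>\<in>P. is_predictor \<pi>) \<longrightarrow> (\<exists>f\<in>F. \<forall>\<pi>\<in>P. evades f \<pi>))"

definition e' :: "(nat \<Rightarrow> nat) rel" where
  "e' = least_card {F. evading_family F}"

end

theory Submission
  imports Defs
begin

text \<open>
  Given an evading family \<open>F\<close>, let \<open>G\<close> be generated by the unit vectors and, for each \<open>f \<in> F\<close>,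
  the quotients of the tails of \<open>x(i) = 2\<^sup>i f(i)\<close> by \<open>2\<^sup>l\<close> and of
  \<open>y(i) = r\<^sub>i \<Prod>\<^sub>j\<^sub><\<^sub>i r\<^sub>j\<^sup>2\<close>, where \<open>r\<^sub>i = f(i) + 1\<close>, by \<open>\<Prod>\<^sub>j\<^sub><\<^sub>l r\<^sub>j\<^sup>2\<close>. Let \<open>h\<close> be a homomorphism on \<open>G\<close>
  with \<open>c\<^sub>k = h(e\<^sub>k) \<noteq> 0\<close> for infinitely many \<open>k\<close>. The value \<open>h(y)\<close> bounds \<open>f(k)\<close> at each such \<open>k\<close>
  by a quantity that depends on \<open>h\<close> and \<open>h(y)\<close> but not on \<open>f\<close>. Hence one can choose \<open>l > k\<close>
  independently of \<open>f\<close> so that the residue of \<open>2\<^sup>k f(k) c\<^sub>k\<close> modulo \<open>2\<^sup>l\<close> determines \<open>f(k)\<close>, and this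
  residue can be read off from \<open>h(x)\<close> and the values \<open>f(i)\<close>, \<open>i < l\<close>, \<open>i \<noteq> k\<close>. There are countably
  many pairs \<open>(h(x), h(y))\<close>, so countably many predictors predict all of \<open>F\<close>, a contradiction.
\<close>

section \<open>Predictors\<close>

text \<open>Supplies the positions of a predictor whose bounds are computed from them by
  \<open>L\<close>.\<close>

lemma exists_spaced_enumeration:
  fixes L :: "nat \<Rightarrow> nat"
  assumes "\<exists>\<^sub>\<infinity>k. Q k"
  obtains p :: "nat \<Rightarrow> nat" where "\<And>n. Q (p n)" "\<And>n. L (p n) < p (Suc n)"
proof -
  have "\<exists>p. \<forall>n. Q (p n) \<and> L (p n) < p (Suc n)"
  proof (rule dependent_nat_choice)
    show "\<exists>k. Q k" using assms by (auto dest: INFM_EX)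
    show "\<exists>k'. Q k' \<and> L k < k'" for k
      using assms unfolding INFM_nat by blast
  qed
  then show thesis using that by blast
qed

lemma is_predictor_restrict:
  assumes "\<And>n. p n \<le> l n" "\<And>n. l n < p (Suc n)"
  shows "is_predictor \<lparr>pos = p, bnd = l,
           guess = \<lambda>n. restrict (g n) (({..<l n} - {p n}) \<rightarrow>\<^sub>E UNIV)\<rparr>"
  using assms by (auto simp: is_predictor_def window_def)

lemma predicts_restrict:
  assumes "\<And>n. g n (restrict f ({..<l n} - {p n})) = f (p n)"
  shows "predicts \<lparr>pos = p, bnd = l,
           guess = \<lambda>n. restrict (g n) (({..<l n} - {p n}) \<rightarrow>\<^sub>E UNIV)\<rparr> f"
  using assms by (simp add: predicts_def window_def)

text \<open>Each \<open>f\<close> is predicted by the predictor that guesses its values outright.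
  The lemma makes \<open>F\<close> infinite, so that adjoining countably many generators for each
  \<open>f\<close> does not exceed \<open>|F|\<close>.\<close>

lemma evading_family_uncountable:
  assumes "evading_family F"
  shows "uncountable F"
proof
  assume "countable F"
  define \<pi> :: "(nat \<Rightarrow> nat) \<Rightarrow> predictor" where
    "\<pi> f = \<lparr>pos = (\<lambda>n. n), bnd = (\<lambda>n. n),
              guess = \<lambda>n. restrict (\<lambda>_. f n) (({..<n} - {n}) \<rightarrow>\<^sub>E UNIV)\<rparr>" for f
  have "is_predictor (\<pi> f)" for f
    unfolding \<pi>_def by (rule is_predictor_restrict) auto
  moreover have "predicts (\<pi> f) f" for f
    unfolding \<pi>_def by (rule predicts_restrict) auto
  moreover have "countable (\<pi> ` F) \<and> (\<forall>\<rho>\<in>\<pi> ` F. is_predictor \<rho>)"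
    using \<open>countable F\<close> \<open>\<And>f. is_predictor (\<pi> f)\<close> by blast
  then have "\<exists>f\<in>F. \<forall>\<rho>\<in>\<pi> ` F. evades f \<rho>"
    using assms unfolding evading_family_def by (elim allE) (rule mp)
  ultimately show False by blast
qed

text \<open>One step of a diagonal construction, starting from the finite condition \<open>f\<close>
  below \<open>N\<close>. The window omits the position, so changing \<open>f\<close> there leaves
  the guess unchanged and can falsify it.\<close>

lemma exists_wrong_guess_extension:
  assumes "is_predictor \<pi>"
  shows "\<exists>N' f'. N \<le> N' \<and> (\<forall>i<N. f' i = f i) \<and>
    (\<exists>n\<ge>s. \<forall>g. (\<forall>i<N'. g i = f' i) \<longrightarrow> guess \<pi> n (restrict g (window \<pi> n)) \<noteq> g (pos \<pi> n))"
proof -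
  have step: "pos \<pi> n \<le> bnd \<pi> n" "bnd \<pi> n < pos \<pi> (Suc n)" for n
    using assms by (auto simp: is_predictor_def)
  then have "strict_mono (pos \<pi>)"
    by (metis le_less_trans strict_mono_Suc_iff)
  define n where "n = max s N"
  have n: "N \<le> pos \<pi> n" "s \<le> n"
    using strict_mono_imp_increasing[OF \<open>strict_mono (pos \<pi>)\<close>, of n] by (auto simp: n_def)
  define f' where "f' = f (pos \<pi> n := Suc (guess \<pi> n (restrict f (window \<pi> n))))"
  \<comment> \<open>The new condition must reach \<open>Suc (bnd \<pi> n)\<close>, since the
    position may equal the bound.\<close>
  have "guess \<pi> n (restrict g (window \<pi> n)) \<noteq> g (pos \<pi> n)"
    if g: "\<forall>i<Suc (bnd \<pi> n). g i = f' i" for g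
  proof -
    have "restrict g (window \<pi> n) = restrict f (window \<pi> n)"
      using g by (intro restrict_ext) (auto simp: f'_def window_def)
    moreover have "g (pos \<pi> n) = f' (pos \<pi> n)"
      using g step(1)[of n] by simp
    ultimately show ?thesis by (simp add: f'_def)
  qed
  moreover have "N \<le> Suc (bnd \<pi> n)" "\<forall>i<N. f' i = f i"
    using n step(1)[of n] by (auto simp: f'_def)
  ultimately show ?thesis using n(2) by blast
qed

text \<open>Ensures that the least cardinality in \<open>e'\<close> is not taken over an empty
  collection. The evading function is built by finite approximations.\<close>

lemma evading_family_UNIV: "evading_family UNIV"
  unfolding evading_family_def
proof (intro allI impI)
  fix P :: "predictor set"
  assume P: "countable P \<and> (\<forall>\<pi>\<in>P. is_predictor \<pi>)"
  show "\<exists>f\<in>UNIV. \<forall>\<pi>\<in>P. evades f \<pi>"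
  proof (cases "P = {}")
    case False
    \<comment> \<open>Decoding pairs lists every predictor infinitely often, so each one guesses
      wrongly at arbitrarily large indices.\<close>
    define \<pi> where "\<pi> s = from_nat_into P (fst (prod_decode s))" for s
    have \<pi>: "is_predictor (\<pi> s)" for s
      using P False by (simp add: \<pi>_def from_nat_into)
    define R where "R s u v \<longleftrightarrow> fst u \<le> fst v \<and> (\<forall>i<fst u. snd v i = snd u i) \<and>
        (\<exists>n\<ge>s. \<forall>g. (\<forall>i<fst v. g i = snd v i) \<longrightarrow>
           guess (\<pi> s) n (restrict g (window (\<pi> s) n)) \<noteq> g (pos (\<pi> s) n))"
      for s and u v :: "nat \<times> (nat \<Rightarrow> nat)"
    have "\<exists>S. \<forall>s. True \<and> R s (S s) (S (Suc s))"
    proof (rule dependent_nat_choice)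
      fix u s
      obtain N' f' where "R s u (N', f')"
        using exists_wrong_guess_extension[OF \<pi>, of "fst u" "snd u" s s]
        unfolding R_def fst_conv snd_conv by metis
      then show "\<exists>v. True \<and> R s u v" by blast
    qed auto
    then obtain S where S: "\<And>s. R s (S s) (S (Suc s))" by blast
    have ext: "fst (S s) \<le> fst (S t) \<and> (\<forall>i<fst (S s). snd (S t) i = snd (S s) i)"
      if "s \<le> t" for s t
      using that
    proof (induction t rule: dec_induct)
      case (step t)
      then show ?case using S[of t] unfolding R_def by auto
    qed auto
    define g where "g i = snd (S (LEAST s. i < fst (S s))) i" for i
    have g: "g i = snd (S s) i" if "i < fst (S s)" for s i
    proof -
      have "i < fst (S (LEAST s. i < fst (S s)))" using that by (rule LeastI)
      moreover have "(LEAST s. i < fst (S s)) \<le> s" using that by (rule Least_le)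
      ultimately show ?thesis unfolding g_def using ext by auto
    qed
    have wrong: "\<exists>n\<ge>s. guess (\<pi> s) n (restrict g (window (\<pi> s) n)) \<noteq> g (pos (\<pi> s) n)" for s
      using S[of s] g[of _ "Suc s"] unfolding R_def by blast
    have "evades g \<rho>" if "\<rho> \<in> P" for \<rho>
    proof -
      obtain j where j: "from_nat_into P j = \<rho>"
        using from_nat_into_surj[of P \<rho>] P \<open>\<rho> \<in> P\<close> by blast
      have "\<exists>n\<ge>s. guess \<rho> n (restrict g (window \<rho> n)) \<noteq> g (pos \<rho> n)" for s
        using wrong[of "prod_encode (j, s)"] le_prod_encode_2[of s j] j
        by (auto simp: \<pi>_def intro: order_trans)
      then show ?thesis
        unfolding predicts_def MOST_nat_le by blast
    qed
    then show ?thesis by blast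
  qed auto
qed

text \<open>The predictors are indexed by the integer pairs \<open>(a, b)\<close>. At position
  \<open>k\<close> the guess is a value below \<open>B b k\<close> that satisfies the congruence
  modulo \<open>2 ^ l\<close>; it is unique because two such values differ by less than
  \<open>B b k\<close>.\<close>

lemma predicted_by_bounded_congruences:
  fixes c :: "nat \<Rightarrow> int"
  assumes "\<exists>\<^sub>\<infinity>k. c k \<noteq> 0"
  obtains P where "countable P" "\<And>\<pi>. \<pi> \<in> P \<Longrightarrow> is_predictor \<pi>"
    "\<And>f a b. \<lbrakk>\<And>l. 2 ^ l dvd a - (\<Sum>i<l. 2 ^ i * int (f i) * c i);
        \<And>k. c k \<noteq> 0 \<Longrightarrow> int (f k) < b + (\<Sum>i\<le>k. \<bar>c i\<bar>)\<rbrakk> \<Longrightarrow> \<exists>\<pi>\<in>P. predicts \<pi> f"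
proof -
  define B where "B b k = b + (\<Sum>i\<le>k. \<bar>c i\<bar>)" for b k
  \<comment> \<open>If \<open>B b k\<close> is positive, \<open>l = L b k\<close> makes
    \<open>2 ^ (l - k)\<close> exceed \<open>B b k * |c k|\<close>, so no nonzero
    \<open>(f k - v) * c k\<close> with both values below \<open>B b k\<close> is a multiple of it.
    Otherwise \<open>nat\<close> gives \<open>l = k\<close>, still an admissible bound.\<close>
  define L where "L b k = k + nat (B b k * \<bar>c k\<bar>)" for b k
  have "\<exists>p. \<forall>n. c (p n) \<noteq> 0 \<and> L b (p n) < p (Suc n)" for b
    using exists_spaced_enumeration[OF assms, of "L b"] by metis
  then obtain p where p: "\<And>b n. c (p b n) \<noteq> 0" "\<And>b n. L b (p b n) < p b (Suc n)"
    by metis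
  define l where "l b n = L b (p b n)" for b n
  define ok where "ok a b n s v \<longleftrightarrow> int v < B b (p b n) \<and>
      2 ^ l b n dvd a - (\<Sum>i<l b n. 2 ^ i * int ((s(p b n := v)) i) * c i)"
    for a b n s v
  define \<pi> where "\<pi> = (\<lambda>(a, b). \<lparr>pos = p b, bnd = l b,
      guess = \<lambda>n. restrict (\<lambda>s. SOME v. ok a b n s v) (({..<l b n} - {p b n}) \<rightarrow>\<^sub>E UNIV)\<rparr>)"
  show thesis
  proof
    show "countable (range \<pi>)" by simp
    show "is_predictor \<rho>" if "\<rho> \<in> range \<pi>" for \<rho>
    proof -
      have "p b n \<le> l b n" "l b n < p b (Suc n)" for b n
        using p(2) by (auto simp: l_def L_def)
      then show ?thesis
        using that by (auto simp: \<pi>_def intro!: is_predictor_restrict)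
    qed
    fix f a b
    assume cong: "\<And>l. 2 ^ l dvd a - (\<Sum>i<l. 2 ^ i * int (f i) * c i)"
      and bound: "\<And>k. c k \<noteq> 0 \<Longrightarrow> int (f k) < b + (\<Sum>i\<le>k. \<bar>c i\<bar>)"
    have "predicts (\<pi> (a, b)) f"
      unfolding \<pi>_def prod.case
    proof (rule predicts_restrict)
      fix n
      let ?k = "p b n" and ?l = "l b n"
      let ?s = "restrict f ({..<?l} - {?k})"
      define C where "C = (\<Sum>i\<in>{..<?l} - {?k}. 2 ^ i * int (f i) * c i)"
      have k: "c ?k \<noteq> 0" by (fact p)
      have fk: "int (f ?k) < B b ?k" using bound[OF k] by (simp add: B_def)
      then have "0 < B b ?k * \<bar>c ?k\<bar>" using k by simp
      then have kl: "?k < ?l" by (simp add: l_def L_def)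
      have sum: "(\<Sum>i<?l. 2 ^ i * int ((?s(?k := v)) i) * c i) = 2 ^ ?k * int v * c ?k + C" for v
        using kl by (subst sum.remove[of _ ?k]) (auto simp: C_def intro!: sum.cong)
      have "(\<Sum>i<?l. 2 ^ i * int (f i) * c i) = 2 ^ ?k * int (f ?k) * c ?k + C"
        using kl by (subst sum.remove[of _ ?k]) (auto simp: C_def)
      then have "ok a b n ?s (f ?k)"
        using cong[of ?l] fk by (simp only: ok_def sum simp_thms)
      moreover have "v = f ?k" if v: "ok a b n ?s v" for v
      proof (rule ccontr)
        assume "v \<noteq> f ?k"
        let ?d = "(int (f ?k) - int v) * c ?k"
        have "2 ^ ?l dvd a - (2 ^ ?k * int w * c ?k + C)" if "ok a b n ?s w" for w
          using that unfolding ok_def sum by (rule conjunct2)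
        from dvd_diff[OF this[OF v] this[OF \<open>ok a b n ?s (f ?k)\<close>]]
        have "2 ^ ?k * 2 ^ nat (B b ?k * \<bar>c ?k\<bar>) dvd 2 ^ ?k * ?d"
          by (simp add: l_def L_def power_add right_diff_distrib left_diff_distrib mult.assoc)
        then have "2 ^ nat (B b ?k * \<bar>c ?k\<bar>) dvd ?d"
          by (simp only: dvd_mult_cancel_left) simp
        then have "2 ^ nat (B b ?k * \<bar>c ?k\<bar>) \<le> \<bar>?d\<bar>"
          using \<open>v \<noteq> f ?k\<close> k by (intro zdvd_imp_le) (simp_all only: dvd_abs_iff, simp)
        also have "\<dots> \<le> B b ?k * \<bar>c ?k\<bar>"
          unfolding abs_mult using v fk by (intro mult_right_mono) (auto simp: ok_def)
        also have "\<dots> = int (nat (B b ?k * \<bar>c ?k\<bar>))"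
          using \<open>0 < B b ?k * \<bar>c ?k\<bar>\<close> by simp
        also have "\<dots> < 2 ^ nat (B b ?k * \<bar>c ?k\<bar>)"
          by (rule of_nat_less_two_power)
        finally show False by simp
      qed
      ultimately show "(SOME v. ok a b n ?s v) = f ?k" by (rule some_equality)
    qed
    then show "\<exists>\<rho>\<in>range \<pi>. predicts \<rho> f" by blast
  qed
qed

section \<open>Bounds from congruences\<close>

text \<open>The squares leave a factor \<open>f k + 1\<close> in the modulus
  \<open>sq_prod f (Suc k)\<close> after \<open>(f k + 1) * sq_prod f k\<close>, the coefficient of
  \<open>c k\<close>, is cancelled.\<close>

definition sq_prod :: "(nat \<Rightarrow> nat) \<Rightarrow> nat \<Rightarrow> int" where
  "sq_prod f l = (\<Prod>i<l. (int (f i) + 1)\<^sup>2)"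

lemma sq_prod_Suc: "sq_prod f (Suc l) = sq_prod f l * (int (f l) + 1)\<^sup>2"
  by (simp add: sq_prod_def)

lemma sq_prod_pos: "0 < sq_prod f l"
  by (auto simp: sq_prod_def intro!: prod_pos)

lemma sq_prod_dvd: "l \<le> i \<Longrightarrow> sq_prod f l dvd sq_prod f i"
  unfolding sq_prod_def by (rule prod_dvd_prod_subset) auto

text \<open>
  Writing \<open>A\<^sub>k\<close> for \<open>sq_prod f k\<close>, the terms below \<open>k\<close> are at most \<open>A\<^sub>k \<bar>c\<^sub>i\<bar>\<close>, while the rest is
  \<open>A\<^sub>k r\<^sub>k (c\<^sub>k + r\<^sub>k t)\<close>, which is at least \<open>A\<^sub>k r\<^sub>k\<close> in absolute value unless \<open>r\<^sub>k\<close> divides \<open>c\<^sub>k\<close>.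
\<close>

lemma bounded_of_sq_prod_congruences:
  fixes c :: "nat \<Rightarrow> int"
  assumes cong: "\<And>l. sq_prod f l dvd b - (\<Sum>i<l. (int (f i) + 1) * sq_prod f i * c i)"
    and "c k \<noteq> 0"
  shows "int (f k) < \<bar>b\<bar> + (\<Sum>i\<le>k. \<bar>c i\<bar>)"
proof -
  let ?r = "\<lambda>i. int (f i) + 1" and ?A = "sq_prod f"
  define m where "m = b - (\<Sum>i<k. ?r i * ?A i * c i)"
  have "\<bar>?r i * ?A i * c i\<bar> \<le> ?A k * \<bar>c i\<bar>" if "i < k" for i
  proof -
    have "?r i * ?A i \<le> ?A (Suc i)"
      using sq_prod_pos[of f i] by (simp add: sq_prod_Suc power2_eq_square algebra_simps)
    also have "\<dots> \<le> ?A k"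
      using that sq_prod_dvd[of "Suc i" k f] sq_prod_pos[of f k] by (intro zdvd_imp_le) auto
    finally show ?thesis
      using sq_prod_pos[of f i] by (auto simp: abs_mult intro!: mult_right_mono)
  qed
  then have "(\<Sum>i<k. \<bar>?r i * ?A i * c i\<bar>) \<le> (\<Sum>i<k. ?A k * \<bar>c i\<bar>)"
    by (intro sum_mono) (simp only: lessThan_iff)
  then have "\<bar>\<Sum>i<k. ?r i * ?A i * c i\<bar> \<le> ?A k * (\<Sum>i<k. \<bar>c i\<bar>)"
    using sum_abs[of "\<lambda>i. ?r i * ?A i * c i" "{..<k}"]
    unfolding sum_distrib_left by (rule order_trans[rotated])
  moreover have "1 * \<bar>b\<bar> \<le> ?A k * \<bar>b\<bar>"
    using sq_prod_pos[of f k] by (intro mult_right_mono) auto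
  ultimately have m: "\<bar>m\<bar> \<le> ?A k * (\<bar>b\<bar> + (\<Sum>i<k. \<bar>c i\<bar>))"
    unfolding m_def distrib_left by linarith
  obtain t where "b - (\<Sum>i<Suc k. ?r i * ?A i * c i) = ?A (Suc k) * t"
    using cong[of "Suc k"] by (rule dvdE)
  then have "m = ?A k * (?r k * (c k + ?r k * t))"
    by (simp add: m_def sq_prod_Suc power2_eq_square algebra_simps)
  then have "\<bar>m\<bar> = ?A k * (?r k * \<bar>c k + ?r k * t\<bar>)"
    using sq_prod_pos[of f k] by (simp add: abs_mult)
  then have le: "?r k * \<bar>c k + ?r k * t\<bar> \<le> \<bar>b\<bar> + (\<Sum>i<k. \<bar>c i\<bar>)"
    using m by (simp only: mult_le_cancel_left_pos[OF sq_prod_pos])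
  have nonneg: "0 \<le> (\<Sum>i<k. \<bar>c i\<bar>)" by (simp add: sum_nonneg)
  have split: "(\<Sum>i\<le>k. \<bar>c i\<bar>) = (\<Sum>i<k. \<bar>c i\<bar>) + \<bar>c k\<bar>"
    by (simp flip: lessThan_Suc_atMost)
  show ?thesis
  proof (cases "c k + ?r k * t = 0")
    \<comment> \<open>Here \<open>f k + 1\<close> divides the nonzero \<open>c k\<close>; this case
      is why the final bound includes the index \<open>k\<close> itself.\<close>
    case True
    then have "?r k dvd c k" by (metis add.commute dvd_add_left_iff dvd_0_right dvd_triv_left)
    then have "?r k \<le> \<bar>c k\<bar>" using \<open>c k \<noteq> 0\<close> by (intro zdvd_imp_le) auto
    then show ?thesis using nonneg unfolding split by linarith
  next
    case False
    then have "?r k * 1 \<le> ?r k * \<bar>c k + ?r k * t\<bar>"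
      by (intro mult_left_mono) auto
    then have "?r k \<le> \<bar>b\<bar> + (\<Sum>i<k. \<bar>c i\<bar>)"
      using le unfolding mult_1_right by (rule order_trans)
    then show ?thesis unfolding split by linarith
  qed
qed

section \<open>Cardinality of generated subgroups\<close>

text \<open>\<open>generate\<close> inverts generators only, so countably many stages exhaust it:
  start from the unit, \<open>S\<close> and its inverses, then repeatedly add products. Neither a
  stage nor the union exceeds the infinite \<open>|B|\<close>.\<close>

lemma card_of_generate_ordLeq_infinite:
  fixes B :: "'b set"
  assumes "infinite B" and "|S| \<le>o |B|"
  shows "|generate \<G> S| \<le>o |B|"
proof -
  define step where "step A = A \<union> (\<lambda>(x, y). x \<otimes>\<^bsub>\<G>\<^esub> y) ` (A \<times> A)" for A
  define A where "A n = (step ^^ n) ({\<one>\<^bsub>\<G>\<^esub>} \<union> (S \<union> m_inv \<G> ` S))" for n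
  have A_Suc: "A (Suc n) = step (A n)" for n by (simp add: A_def)
  have A_mono: "A m \<subseteq> A n" if "m \<le> n" for m n
    using _ that by (rule lift_Suc_mono_le) (auto simp: A_Suc step_def)
  have "|A n| \<le>o |B|" for n
  proof (induction n)
    case 0
    have "|{\<one>\<^bsub>\<G>\<^esub>}| \<le>o |B|"
      using assms(1) by (intro card_of_singl_ordLeq) auto
    moreover have "|m_inv \<G> ` S| \<le>o |B|"
      using card_of_image assms(2) by (rule ordLeq_transitive)
    ultimately show ?case
      unfolding A_def funpow_0 using assms by (intro card_of_Un_ordLeq_infinite)
  next
    case (Suc n)
    then show ?case
      unfolding A_Suc step_def using assms(1)
      by (intro card_of_Un_ordLeq_infinite card_of_image[THEN ordLeq_transitive]
          card_of_Times_ordLeq_infinite) auto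
  qed
  moreover have "|UNIV :: nat set| \<le>o |B|"
    using assms(1) by (simp add: infinite_iff_card_of_nat)
  ultimately have "|\<Union>n. A n| \<le>o |B|"
    using assms(1) by (intro card_of_UNION_ordLeq_infinite) auto
  moreover have "x \<in> (\<Union>n. A n)" if "x \<in> generate \<G> S" for x
    using that
  proof induction
    case (eng x y)
    then obtain m n where "x \<in> A m" "y \<in> A n" by blast
    then have "x \<in> A (max m n)" "y \<in> A (max m n)"
      using A_mono[of m "max m n"] A_mono[of n "max m n"] by auto
    then have "x \<otimes>\<^bsub>\<G>\<^esub> y \<in> A (Suc (max m n))"
      unfolding A_Suc step_def by (intro UnI2 rev_image_eqI[of "(x, y)"]) auto
    then show ?case by blast
  qed (auto simp: A_def intro!: exI[of _ 0])
  ultimately show ?thesis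
    by (meson card_of_mono1 ordLeq_transitive subsetI)
qed

section \<open>Homomorphisms on subgroups closed under tails\<close>

text \<open>Applied where \<open>d\<close> divides every entry from \<open>l\<close> on, so that the
  division is exact and \<open>d\<close> times this vector is the tail of \<open>x\<close>.\<close>

definition div_tail :: "(nat \<Rightarrow> int) \<Rightarrow> int \<Rightarrow> nat \<Rightarrow> nat \<Rightarrow> int" where
  "div_tail x d l = (\<lambda>i. if i < l then 0 else x i div d)"

lemma group_Z_omega [simp]: "group Z_omega"
  and carrier_Z_omega [simp]: "carrier Z_omega = UNIV"
  and one_Z_omega [simp]: "\<one>\<^bsub>Z_omega\<^esub> = (\<lambda>_. 0)"
  and mult_Z_omega [simp]: "x \<otimes>\<^bsub>Z_omega\<^esub> y = (\<lambda>i. x i + y i)"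
  by (auto simp: Z_omega_def PiE_UNIV_domain)

lemma inv_Z_omega [simp]: "inv\<^bsub>Z_omega\<^esub> x = (\<lambda>i. - x i)"
  by (simp add: Z_omega_def PiE_UNIV_domain fun_eq_iff)

locale Z_omega_functional =
  fixes G h
  assumes subgroup: "subgroup G Z_omega"
    and unit: "\<And>n. unit_vec n \<in> G"
    and hom: "h \<in> hom (Z_omega\<lparr>carrier := G\<rparr>) integer_group"
begin

lemma zero_mem: "(\<lambda>_. 0) \<in> G"
  using subgroup.one_closed[OF subgroup] by simp

lemma add_mem: "x \<in> G \<Longrightarrow> y \<in> G \<Longrightarrow> (\<lambda>i. x i + y i) \<in> G"
  using subgroup.m_closed[OF subgroup] by simp

lemma uminus_mem: "x \<in> G \<Longrightarrow> (\<lambda>i. - x i) \<in> G"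
  using subgroup.m_inv_closed[OF subgroup] by simp

lemma add: "x \<in> G \<Longrightarrow> y \<in> G \<Longrightarrow> h (\<lambda>i. x i + y i) = h x + h y"
  using hom by (simp add: hom_def)

lemma zero: "h (\<lambda>_. 0) = 0"
  using add[OF zero_mem zero_mem] by simp

lemma uminus: "x \<in> G \<Longrightarrow> h (\<lambda>i. - x i) = - h x"
  using add[OF _ uminus_mem, of x x] zero by simp

lemma scale: "x \<in> G \<Longrightarrow> (\<lambda>i. c * x i) \<in> G \<and> h (\<lambda>i. c * x i) = c * h x"
proof (induction c rule: int_induct[of _ 0])
  case base
  then show ?case by (simp add: zero zero_mem)
next
  case (step1 c)
  then show ?case
    using add_mem[of "\<lambda>i. c * x i" x] add[of "\<lambda>i. c * x i" x] by (simp add: algebra_simps)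
next
  case (step2 c)
  then show ?case
    using add_mem[of "\<lambda>i. c * x i" "\<lambda>i. - x i"] add[of "\<lambda>i. c * x i" "\<lambda>i. - x i"]
      uminus_mem[of x] uminus[of x]
    by (simp add: algebra_simps)
qed

lemma finite_part:
  "(\<lambda>i. if i < l then x i else 0) \<in> G \<and>
   h (\<lambda>i. if i < l then x i else 0) = (\<Sum>i<l. x i * h (unit_vec i))"
proof (induction l)
  case (Suc l)
  have "(\<lambda>i. if i < Suc l then x i else 0) =
      (\<lambda>i. (if i < l then x i else 0) + x l * unit_vec l i)"
    by (auto simp: unit_vec_def fun_eq_iff less_Suc_eq)
  then show ?case
    using Suc scale[OF unit, of "x l" l] add_mem add by simp
qed (simp add: zero zero_mem)

text \<open>\<open>x\<close> is a finite part plus \<open>d\<close> times a member of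
  \<open>G\<close>, on which \<open>h\<close> takes an integer value; so the first \<open>l\<close>
  entries determine \<open>h x\<close> modulo \<open>d\<close>.\<close>

lemma tail_dvd:
  assumes "div_tail x d l \<in> G" and "\<And>i. l \<le> i \<Longrightarrow> d dvd x i"
  shows "d dvd h x - (\<Sum>i<l. x i * h (unit_vec i))"
proof -
  have "x = (\<lambda>i. (if i < l then x i else 0) + d * div_tail x d l i)"
    using assms(2) by (auto simp: fun_eq_iff div_tail_def)
  then have "h x = h (\<lambda>i. (if i < l then x i else 0) + d * div_tail x d l i)"
    by (rule arg_cong)
  also have "\<dots> = (\<Sum>i<l. x i * h (unit_vec i)) + d * h (div_tail x d l)"
    using finite_part[of l x] scale[OF assms(1), of d] by (simp only: add)
  finally show ?thesis by simp
qed

end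

section \<open>From evading families to Specker subgroups\<close>

lemma specker_subgroup_of_evading_family:
  assumes F: "evading_family F"
  shows "\<exists>G. specker_subgroup G \<and> |G| \<le>o |F|"
proof -
  define x where "x f i = 2 ^ i * int (f i)" for f :: "nat \<Rightarrow> nat" and i
  define y where "y f i = (int (f i) + 1) * sq_prod f i" for f i
  define S where "S = range unit_vec \<union> ((\<lambda>(f, l). div_tail (x f) (2 ^ l) l) ` (F \<times> UNIV) \<union>
      (\<lambda>(f, l). div_tail (y f) (sq_prod f l) l) ` (F \<times> UNIV))"
  define G where "G = generate Z_omega S"
  have "infinite F"
    using evading_family_uncountable[OF F] countable_finite by blast
  then have nat: "|UNIV :: nat set| \<le>o |F|" by (simp add: infinite_iff_card_of_nat)
  then have "|S| \<le>o |F|"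
    unfolding S_def using \<open>infinite F\<close> card_of_refl[THEN ordIso_imp_ordLeq]
    by (intro card_of_Un_ordLeq_infinite card_of_image[THEN ordLeq_transitive]
        card_of_Times_ordLeq_infinite) auto
  then have "|G| \<le>o |F|"
    unfolding G_def using \<open>infinite F\<close> by (intro card_of_generate_ordLeq_infinite)
  moreover have "specker_subgroup G"
    unfolding specker_subgroup_def
  proof (intro conjI ballI)
    show sub: "subgroup G Z_omega"
      unfolding G_def by (intro group.generate_is_subgroup) auto
    have SG: "S \<subseteq> G" unfolding G_def by (auto intro: generate.incl)
    then have unit: "unit_vec n \<in> G" for n by (auto simp: S_def)
    then show "unit_vec_sum \<subseteq> G"
      unfolding unit_vec_sum_def using sub
      by (intro group.generate_subgroup_incl UN_least) auto
    fix h assume h: "h \<in> hom (Z_omega\<lparr>carrier := G\<rparr>) integer_group"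
    interpret Z_omega_functional G h
      using sub unit h by (rule Z_omega_functional.intro)
    show "\<forall>\<^sub>\<infinity>n. h (unit_vec n) = 0"
    proof (rule ccontr)
      assume "\<not> (\<forall>\<^sub>\<infinity>n. h (unit_vec n) = 0)"
      then have inf: "\<exists>\<^sub>\<infinity>n. h (unit_vec n) \<noteq> 0" by (simp add: not_eventually)
      \<comment> \<open>The family \<open>P\<close> depends only on the values of \<open>h\<close>
        at the unit vectors, so it is fixed before \<open>f\<close> is chosen to evade it.\<close>
      show False
      proof (rule predicted_by_bounded_congruences[OF inf])
        fix P assume P: "countable P" "\<And>\<pi>. \<pi> \<in> P \<Longrightarrow> is_predictor \<pi>"
          and pred: "\<And>f a b. \<lbrakk>\<And>l. 2 ^ l dvd a - (\<Sum>i<l. 2 ^ i * int (f i) * h (unit_vec i));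
            \<And>k. h (unit_vec k) \<noteq> 0 \<Longrightarrow> int (f k) < b + (\<Sum>i\<le>k. \<bar>h (unit_vec i)\<bar>)\<rbrakk>
              \<Longrightarrow> \<exists>\<pi>\<in>P. predicts \<pi> f"
        have "countable P \<and> (\<forall>\<pi>\<in>P. is_predictor \<pi>)" using P by blast
        then obtain f where f: "f \<in> F" "\<And>\<pi>. \<pi> \<in> P \<Longrightarrow> evades f \<pi>"
          using F unfolding evading_family_def by metis
        have "div_tail (x f) (2 ^ l) l \<in> G" "div_tail (y f) (sq_prod f l) l \<in> G" for l
          using SG f(1) unfolding S_def by fast+
        moreover have "2 ^ l dvd x f i" "sq_prod f l dvd y f i" if "l \<le> i" for l i
          using that by (simp_all add: x_def y_def le_imp_power_dvd sq_prod_dvd)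
        ultimately have x_cong: "2 ^ l dvd h (x f) - (\<Sum>i<l. x f i * h (unit_vec i))"
          and y_cong: "sq_prod f l dvd h (y f) - (\<Sum>i<l. y f i * h (unit_vec i))" for l
          by (simp_all add: tail_dvd)
        have "\<exists>\<pi>\<in>P. predicts \<pi> f"
        proof (rule pred[of "h (x f)" f "\<bar>h (y f)\<bar>"])
          show "2 ^ l dvd h (x f) - (\<Sum>i<l. 2 ^ i * int (f i) * h (unit_vec i))" for l
            using x_cong[of l] by (simp only: x_def)
          show "int (f k) < \<bar>h (y f)\<bar> + (\<Sum>i\<le>k. \<bar>h (unit_vec i)\<bar>)"
            if "h (unit_vec k) \<noteq> 0" for k
          proof (rule bounded_of_sq_prod_congruences[of f])
            show "sq_prod f l dvd h (y f) -
                (\<Sum>i<l. (int (f i) + 1) * sq_prod f i * h (unit_vec i))" for l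
              using y_cong[of l] by (simp only: y_def)
          qed (fact that)
        qed
        then obtain \<pi> where "\<pi> \<in> P" "predicts \<pi> f" by (rule bexE)
        then show False using f(2)[of \<pi>] by simp
      qed
    qed
  qed
  ultimately show ?thesis by (intro exI conjI)
qed

theorem mainTheorem7:
  shows "se \<le>o e'"
proof -
  have "e' \<in> card_of ` {F. evading_family F}"
    unfolding e'_def using evading_family_UNIV by (intro least_card_in) auto
  then obtain F where F: "evading_family F" and e': "e' = |F|" by (elim imageE CollectE)
  from specker_subgroup_of_evading_family[OF F]
  obtain G where G: "specker_subgroup G" "|G| \<le>o |F|" by (elim exE conjE)
  have "G \<in> {G. specker_subgroup G}" using G(1) by (rule CollectI)
  \<comment> \<open>\<open>G\<close> itself witnesses that the collection defining \<open>se\<close>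
    is nonempty.\<close>
  then have "se \<le>o |G|"
    unfolding se_def by (intro least_card_le) blast+
  also note G(2)
  finally show ?thesis unfolding e' .
qed

end
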